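(* Let $\alpha\in[0,1)$, let $\varphi:\mathbb{N}^*\to\mathbb{N}^*$ be a strictly increasing map, and let $A_n:\mathbb{N}^{\varphi(n)}\to[0,1]$, $n\ge 1$, be a sequence of measurable functions. 1. Assume that for any probability distribution $\mu_1$ on $\mathbb{N}$ with finite support, $$\limsup_{n\to\infty}\, \mathbb{E}_{\mu_1}\bigl[A_n(X_1,\ldots,X_{\varphi(n)})\bigr]\le \alpha.$$ Then there exists a probability distribution $\mu_2$ on $\mathbb{N}$ with infinite support such that $$\liminf_{n\to\infty}\, \mathbb{E}_{\mu_2}\bigl[A_n(X_1,\ldots,X_{\varphi(n)})\bigr]\le \alpha.$$ 2. Assume that for any probability distribution $\mu_2$ on $\mathbb{N}$ with infinite support, $$\limsup_{n\to\infty}\, \mathbb{E}_{\mu_2}\bigl[A_n(X_1,\ldots,X_{\varphi(n)})\bigr]\le \alpha.$$ Then for all $\alpha'\in(\alpha,1)$ there exists a probability distribution $\mu_1$ on $\mathbb{N}$ with finite support such that $$\liminf_{n\to\infty}\, \mathbb{E}_{\mu_1}\bigl[A_n(X_1,\ldots,X_{\varphi(n)})\bigr]\le \alpha'.$$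
   Context: $\mathbb{N}=\{0,1,2,\ldots\}$ and $\mathbb{N}^*=\{1,2,\ldots\}$. For a probability measure $\mu$ on $\mathbb{N}$, $\mathbb{P}_\mu$ denotes the probability measure on the canonical space $\mathbb{N}^{\mathbb{N}^*}$ under which the canonical (coordinate) process $(X_i)_{i\ge 1}$ is a family of i.i.d. random variables with law $\mu$, and $\mathbb{E}_\mu$ denotes expectation with respect to $\mathbb{P}_\mu$. The support of $\mu$ is $\{k\in\mathbb{N}:\mu(\{k\})>0\}$. *)

theory Defs
  imports "HOL-Probability.Probability"
begin

text \<open>
  A probability distribution on the natural numbers is a \<open>nat pmf\<close>; its support is \<open>set_pmf\<close>.
  Since the time index starts at 1, a trajectory is a function on the index set \<open>{1..}\<close>; as
  usual for product measures it takes the value \<open>undefined\<close> outside of the index set.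
\<close>

definition path_measure :: "nat pmf \<Rightarrow> (nat \<Rightarrow> nat) measure" where
  "path_measure \<mu> = (\<Pi>\<^sub>M i\<in>{1::nat..}. measure_pmf \<mu>)"

definition X :: "nat \<Rightarrow> (nat \<Rightarrow> nat) \<Rightarrow> nat" where
  "X i \<omega> = \<omega> i"

text \<open>
  A point of the \<open>k\<close>-th power of the natural numbers is an extensional function on \<open>{1..k}\<close>.
  The number below is the expectation of \<open>a (X\<^sub>1, \<dots>, X\<^sub>k)\<close> for i.i.d. variables of law \<open>\<mu>\<close>.
\<close>

definition expect :: "nat pmf \<Rightarrow> nat \<Rightarrow> ((nat \<Rightarrow> nat) \<Rightarrow> real) \<Rightarrow> real" where
  "expect \<mu> k a = (\<integral>\<omega>. a (\<lambda>i\<in>{1..k}. X i \<omega>) \<partial>path_measure \<mu>)"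

end

theory Submission imports Defs begin

text \<open>
  If \<open>X\<close> has law \<open>\<mu>\<close>, then \<open>min j X\<close> has finite support, and replacing \<open>X\<close> by \<open>min j X\<close> in \<open>k\<close>
  independent coordinates changes the expectation of a \<open>[0,1]\<close>-valued function by at most
  \<open>k P(X > j)\<close>. Moreover the law of \<open>min j X\<close> depends only on the tails \<open>t i = P(X \<ge> i)\<close> with
  \<open>i \<le> j\<close>. So the tails can be chosen one at a time: the first \<open>j\<close> of them determine a time \<open>n\<close> at
  which the truncated law has expectation below \<open>\<alpha> + 1 / (j + 1)\<close>, and \<open>t (j + 1)\<close> is then taken so
  small that \<open>\<phi> n * t (j + 1)\<close> is negligible. The second part is the first one applied to \<open>1 - A n\<close>,
  by contradiction.
\<close>

section \<open>Coordinatewise images and truncation of i.i.d. sequences\<close>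

text \<open>Only the joint law of the first \<open>k\<close> coordinates matters, and the finite
  product of image laws is the image of the product under \<open>f\<close> applied coordinatewise.
  Both the original and the transformed variables thus live on \<open>path_measure \<mu>\<close>, as
  a coupling requires.\<close>

lemma expect_map_pmf:
  assumes "a \<in> borel_measurable (\<Pi>\<^sub>M i\<in>{1..k}. count_space UNIV)"
  shows "expect (map_pmf f \<mu>) k a = (\<integral>\<omega>. a (\<lambda>i\<in>{1..k}. f (\<omega> i)) \<partial>path_measure \<mu>)"
proof -
  let ?N = "\<Pi>\<^sub>M i\<in>{1..k}. (count_space UNIV :: nat measure)"
  have a [measurable]: "a \<in> borel_measurable ?N" by fact
  have restr: "(\<lambda>\<omega>. restrict \<omega> {1..k}) \<in> measurable (path_measure \<nu>) ?N" for \<nu>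
    unfolding path_measure_def by (rule measurable_restrict) simp
  \<comment> \<open>The two product sigma-algebras have the same sets; the one over
    \<open>count_space\<close> is the one in which \<open>a\<close> is measurable for every
    law.\<close>
  have marg: "distr (path_measure \<nu>) ?N (\<lambda>\<omega>. restrict \<omega> {1..k}) = (\<Pi>\<^sub>M i\<in>{1..k}. measure_pmf \<nu>)" for \<nu>
  proof -
    interpret product_prob_space "\<lambda>_. measure_pmf \<nu>" "{1::nat..}" by unfold_locales
    have "distr (path_measure \<nu>) ?N (\<lambda>\<omega>. restrict \<omega> {1..k}) =
        distr (path_measure \<nu>) (\<Pi>\<^sub>M i\<in>{1..k}. measure_pmf \<nu>) (\<lambda>\<omega>. restrict \<omega> {1..k})"
      by (intro distr_cong sets_PiM_cong) auto
    then show ?thesis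
      unfolding path_measure_def using distr_PiM_restrict_finite[of "{1..k}"] by auto
  qed
  have comp: "compose {1..k} f \<in> measurable ?N ?N"
    unfolding compose_def by (rule measurable_restrict, rule measurable_compose[OF measurable_component_singleton]) auto
  have "expect (map_pmf f \<mu>) k a = (\<integral>x. a x \<partial>distr (path_measure (map_pmf f \<mu>)) ?N (\<lambda>\<omega>. restrict \<omega> {1..k}))"
    unfolding expect_def X_def by (subst integral_distr[OF restr a]) simp
  also have "\<dots> = (\<integral>x. a x \<partial>(\<Pi>\<^sub>M i\<in>{1..k}. measure_pmf (map_pmf f \<mu>)))"
    by (simp only: marg)
  also have "(\<Pi>\<^sub>M i\<in>{1..k}. measure_pmf (map_pmf f \<mu>)) =
      distr (\<Pi>\<^sub>M i\<in>{1..k}. measure_pmf \<mu>) ?N (compose {1..k} f)"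
  proof -
    have "distr (measure_pmf \<mu>) (measure_pmf \<mu>) f = measure_pmf (map_pmf f \<mu>)"
      unfolding map_pmf_rep_eq by (rule distr_cong) auto
    then have "(\<Pi>\<^sub>M i\<in>{1..k}. measure_pmf (map_pmf f \<mu>)) =
        distr (\<Pi>\<^sub>M i\<in>{1..k}. measure_pmf \<mu>) (\<Pi>\<^sub>M i\<in>{1..k}. measure_pmf \<mu>) (compose {1..k} f)"
      using distr_PiM_finite_prob_space'[of "{1..k}" "\<lambda>_. measure_pmf \<mu>" "\<lambda>_. measure_pmf \<mu>" f]
      by (simp add: prob_space_measure_pmf)
    also have "\<dots> = distr (\<Pi>\<^sub>M i\<in>{1..k}. measure_pmf \<mu>) ?N (compose {1..k} f)"
      by (intro distr_cong sets_PiM_cong) auto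
    finally show ?thesis .
  qed
  also have "\<dots> = distr (distr (path_measure \<mu>) ?N (\<lambda>\<omega>. restrict \<omega> {1..k})) ?N (compose {1..k} f)"
    by (simp only: marg)
  also have "\<dots> = distr (path_measure \<mu>) ?N (compose {1..k} f \<circ> (\<lambda>\<omega>. restrict \<omega> {1..k}))"
    by (rule distr_distr[OF comp restr])
  also have "(\<integral>x. a x \<partial>\<dots>) = (\<integral>\<omega>. a (compose {1..k} f (restrict \<omega> {1..k})) \<partial>path_measure \<mu>)"
    by (subst integral_distr[OF measurable_comp[OF restr comp] a]) simp
  also have "\<dots> = (\<integral>\<omega>. a (\<lambda>i\<in>{1..k}. f (\<omega> i)) \<partial>path_measure \<mu>)"
    by (intro Bochner_Integration.integral_cong refl arg_cong[of _ _ a])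
       (auto simp: compose_def fun_eq_iff)
  finally show ?thesis .
qed

text \<open>The coupling of \<open>X\<close> with \<open>min j X\<close>, and a union bound over the \<open>k\<close> coordinates.\<close>

lemma expect_le_expect_truncation:
  assumes a: "a \<in> borel_measurable (\<Pi>\<^sub>M i\<in>{1..k}. count_space UNIV)"
    and range: "a \<in> ({1..k} \<rightarrow>\<^sub>E UNIV) \<rightarrow> {0..1}"
  shows "expect \<mu> k a \<le> expect (map_pmf (min j) \<mu>) k a + real k * measure_pmf.prob \<mu> {j<..}"
proof -
  let ?P = "path_measure \<mu>"
  interpret prob_space ?P
    unfolding path_measure_def by (rule prob_space_PiM) (rule prob_space_measure_pmf)
  have coord [measurable]: "(\<lambda>\<omega>. \<omega> i) \<in> measurable ?P (count_space UNIV)" if "i \<in> {1..k}" for i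
    using measurable_component_singleton[of i "{1..}" "\<lambda>_. measure_pmf \<mu>"] that
    unfolding path_measure_def by simp
  have meas: "(\<lambda>\<omega>. a (\<lambda>i\<in>{1..k}. f (\<omega> i))) \<in> borel_measurable ?P" for f :: "nat \<Rightarrow> nat"
    by (rule measurable_compose[OF _ a], rule measurable_restrict,
        rule measurable_compose[OF coord]) auto
  have bounds: "0 \<le> a (\<lambda>i\<in>{1..k}. f (\<omega> i))" "a (\<lambda>i\<in>{1..k}. f (\<omega> i)) \<le> 1"
    for f :: "nat \<Rightarrow> nat" and \<omega>
    using range by (auto simp: Pi_iff)
  have int: "integrable ?P (\<lambda>\<omega>. a (\<lambda>i\<in>{1..k}. f (\<omega> i)))" for f :: "nat \<Rightarrow> nat"
    by (rule integrable_const_bound[where B = 1]) (use bounds meas in auto)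
  let ?E = "\<lambda>i. {\<omega> \<in> space ?P. j < \<omega> i}"
  have E: "?E i \<in> sets ?P" if "i \<in> {1..k}" for i
    using measurable_sets[OF coord[OF that], of "{j<..}"] by (simp add: vimage_def Int_def conj_commute)
  have prob_E: "prob (?E i) = measure_pmf.prob \<mu> {j<..}" if "i \<in> {1..k}" for i
  proof -
    have "measure_pmf.prob \<mu> {j<..} = measure (distr ?P (measure_pmf \<mu>) (\<lambda>\<omega>. \<omega> i)) {j<..}"
      unfolding path_measure_def
      by (subst distr_PiM_component) (use that in \<open>auto intro: prob_space_measure_pmf\<close>)
    also have "\<dots> = prob ((\<lambda>\<omega>. \<omega> i) -` {j<..} \<inter> space ?P)"
      using coord[OF that] by (intro measure_distr) auto
    also have "(\<lambda>\<omega>. \<omega> i) -` {j<..} \<inter> space ?P = ?E i" by auto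
    finally show ?thesis by simp
  qed
  have int_E: "integrable ?P (indicator (?E i) :: _ \<Rightarrow> real)" if "i \<in> {1..k}" for i
    using E[OF that] by (simp add: emeasure_eq_measure)
  have "expect \<mu> k a = (\<integral>\<omega>. a (\<lambda>i\<in>{1..k}. \<omega> i) \<partial>?P)"
    by (simp add: expect_def X_def)
  \<comment> \<open>Pointwise: if some coordinate exceeds \<open>j\<close>, the sum of indicators is
    at least 1, which bounds \<open>a\<close>; otherwise truncation changes no coordinate.\<close>
  also have "\<dots> \<le> (\<integral>\<omega>. a (\<lambda>i\<in>{1..k}. min j (\<omega> i)) + (\<Sum>i=1..k. indicator (?E i) \<omega>) \<partial>?P)"
  proof (rule integral_mono)
    fix \<omega> assume \<omega>: "\<omega> \<in> space ?P"
    show "a (\<lambda>i\<in>{1..k}. \<omega> i) \<le> a (\<lambda>i\<in>{1..k}. min j (\<omega> i)) + (\<Sum>i=1..k. indicator (?E i) \<omega>)"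
    proof (cases "\<exists>i\<in>{1..k}. j < \<omega> i")
      case True
      then obtain i where i: "i \<in> {1..k}" "j < \<omega> i" by blast
      have "1 = indicator (?E i) \<omega>" using \<omega> i by simp
      also have "\<dots> \<le> (\<Sum>i=1..k. indicator (?E i) \<omega> :: real)"
        by (rule member_le_sum) (use i in auto)
      finally show ?thesis
        using bounds(1)[of "min j" \<omega>] bounds(2)[of "\<lambda>x. x" \<omega>] by linarith
    next
      case False
      then have "(\<lambda>i\<in>{1..k}. \<omega> i) = (\<lambda>i\<in>{1..k}. min j (\<omega> i))"
        by (intro restrict_ext) (auto simp: not_less min_absorb2)
      then show ?thesis by (simp add: sum_nonneg)
    qed
  qed (use int int[of "\<lambda>x. x"] int_E in \<open>auto intro!: Bochner_Integration.integrable_add Bochner_Integration.integrable_sum\<close>)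
  also have "\<dots> = (\<integral>\<omega>. a (\<lambda>i\<in>{1..k}. min j (\<omega> i)) \<partial>?P) + (\<Sum>i=1..k. prob (?E i))"
    using int int_E E by (subst Bochner_Integration.integral_add)
      (auto intro!: Bochner_Integration.integrable_sum simp: Bochner_Integration.integral_sum)
  also have "\<dots> = expect (map_pmf (min j) \<mu>) k a + real k * measure_pmf.prob \<mu> {j<..}"
    using prob_E by (simp add: expect_map_pmf[OF a])
  finally show ?thesis .
qed

section \<open>Laws prescribed by their tails\<close>

text \<open>Here \<open>t k\<close> plays the role of P(X \<ge> k). In these terms truncation at
  \<open>j\<close> just replaces all later values of \<open>t\<close> by 0.\<close>

definition tail_pmf :: "(nat \<Rightarrow> real) \<Rightarrow> nat pmf" where
  "tail_pmf t = embed_pmf (\<lambda>k. t k - t (Suc k))"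

text \<open>The factor 1/2 gives both monotonicity and convergence to 0, and strict decrease
  wherever \<open>t\<close> is positive. The value 0 is allowed so that tails of truncated laws
  qualify too.\<close>

definition halving :: "(nat \<Rightarrow> real) \<Rightarrow> bool" where
  "halving t \<longleftrightarrow> t 0 = 1 \<and> (\<forall>i. 0 \<le> t i \<and> t (Suc i) \<le> t i / 2)"

lemma halving_Suc_le: "halving t \<Longrightarrow> t (Suc k) \<le> t k"
  unfolding halving_def by (metis field_sum_of_halves le_add_same_cancel1 divide_nonneg_pos order_trans zero_less_numeral)

lemma halving_tendsto_0:
  assumes "halving t"
  shows "t \<longlonglongrightarrow> 0"
proof -
  have "t i \<le> (1 / 2) ^ i" for i
  proof (induction i)
    case (Suc i)
    have "t (Suc i) \<le> t i / 2" using assms by (simp add: halving_def)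
    with Suc show ?case by simp
  qed (use assms in \<open>simp add: halving_def\<close>)
  moreover have "0 \<le> t i" for i
    using assms by (simp add: halving_def)
  ultimately show ?thesis
    by (intro tendsto_sandwich[OF _ _ tendsto_const LIMSEQ_power_zero[of "1 / 2 :: real"]]) auto
qed

text \<open>The differences are nonnegative and telescope to \<open>t 0\<close> minus the limit 0,
  hence have sum 1.\<close>

lemma pmf_tail_pmf:
  assumes "halving t"
  shows "pmf (tail_pmf t) k = t k - t (Suc k)"
proof -
  have nonneg: "0 \<le> t i - t (Suc i)" for i
    using halving_Suc_le[OF assms, of i] by simp
  have "(\<lambda>i. t i - t (Suc i)) sums (t 0 - 0)"
    by (rule telescope_sums'[OF halving_tendsto_0[OF assms]])
  then have "(\<lambda>i. t i - t (Suc i)) sums 1"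
    using assms by (simp add: halving_def)
  then have "(\<Sum>i. ennreal (t i - t (Suc i))) = 1"
    using nonneg by (simp add: suminf_ennreal_eq sums_iff)
  then have "(\<integral>\<^sup>+i. ennreal (t i - t (Suc i)) \<partial>count_space UNIV) = 1"
    by (simp add: nn_integral_count_space_nat)
  with nonneg show ?thesis
    unfolding tail_pmf_def by (intro pmf_embed_pmf) auto
qed

lemma prob_tail_pmf_atLeast:
  assumes "halving t"
  shows "measure_pmf.prob (tail_pmf t) {j..} = t j"
proof -
  have "measure_pmf.prob (tail_pmf t) {..<j} = (\<Sum>k<j. t k - t (Suc k))"
    by (simp add: measure_measure_pmf_finite pmf_tail_pmf[OF assms])
  also have "\<dots> = 1 - t j"
    using assms by (simp add: sum_lessThan_telescope' halving_def)
  finally have "measure_pmf.prob (tail_pmf t) {..<j} = 1 - t j" .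
  moreover have "{j..} = space (measure_pmf (tail_pmf t)) - {..<j}" by auto
  ultimately show ?thesis
    using measure_pmf.prob_compl[of "{..<j}" "tail_pmf t"] by simp
qed

lemma halving_truncate: "halving t \<Longrightarrow> halving (\<lambda>i. if i \<le> j then t i else 0)"
  by (auto simp: halving_def)

text \<open>Masses below \<open>j\<close> are untouched, and the whole tail \<open>t j\<close> is
  collected at \<open>j\<close>; this is also the last nonzero difference \<open>t j - 0\<close> of
  the cut sequence.\<close>

lemma map_pmf_min_tail_pmf:
  assumes "halving t"
  shows "map_pmf (min j) (tail_pmf t) = tail_pmf (\<lambda>i. if i \<le> j then t i else 0)"
proof (rule pmf_eqI)
  fix k
  have "min j -` {k} = (if k < j then {k} else if k = j then {j..} else {})"
    by (auto simp: min_def split: if_splits)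
  then show "pmf (map_pmf (min j) (tail_pmf t)) k = pmf (tail_pmf (\<lambda>i. if i \<le> j then t i else 0)) k"
    using assms prob_tail_pmf_atLeast[OF assms, of j]
    by (auto simp: pmf_map pmf_tail_pmf halving_truncate measure_pmf_single)
qed

section \<open>Inductive choice of tails and times\<close>

text \<open>\<open>F n\<close> stands for the expectation at time \<open>n\<close> and
  \<open>c n\<close> for the number of coordinates it involves. The finite stages are chosen
  recursively and their limit is a law whose truncations are exactly these stages.\<close>

lemma exists_infinite_support_frequently_le:
  fixes F :: "nat \<Rightarrow> nat pmf \<Rightarrow> real" and c :: "nat \<Rightarrow> real"
  assumes step: "\<And>n j \<mu>. n \<ge> 1 \<Longrightarrow> F n \<mu> \<le> F n (map_pmf (min j) \<mu>) + c n * measure_pmf.prob \<mu> {j<..}"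
    and c: "\<And>n. 0 \<le> c n"
    and fin: "\<And>\<mu> e. finite (set_pmf \<mu>) \<Longrightarrow> 0 < e \<Longrightarrow> \<forall>\<^sub>F n in sequentially. F n \<mu> \<le> \<alpha> + e"
  shows "\<exists>\<mu>. infinite (set_pmf \<mu>) \<and> (\<forall>e>0. \<forall>N. \<exists>n\<ge>N. F n \<mu> \<le> \<alpha> + e)"
proof -
  \<comment> \<open>Stage \<open>j\<close> has tails fixed up to \<open>j\<close> and a time
    \<open>n\<close> good for the resulting finitely supported law. \<open>Suc j \<le> n\<close>
    makes the times unbounded and at least 1, as \<open>step\<close> demands.\<close>
  define P where "P = (\<lambda>j (t, n). halving t \<and> (\<forall>i\<le>j. 0 < t i) \<and> (\<forall>i>j. t i = 0) \<and>
    Suc j \<le> n \<and> F n (tail_pmf t) \<le> \<alpha> + 1 / Suc j)"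
  \<comment> \<open>The next stage keeps the earlier tails and makes the new one small relative to
    the time already chosen.\<close>
  define Q where "Q = (\<lambda>j (t, n) (t' :: nat \<Rightarrow> real, n' :: nat).
    (\<forall>i\<le>j. t' i = t i) \<and> c n * t' (Suc j) \<le> 1 / Suc j)"
  have time: "\<exists>n. P j (t, n)" if t: "halving t" "\<forall>i\<le>j. 0 < t i" "\<forall>i>j. t i = 0" for j t
  proof -
    have "set_pmf (tail_pmf t) \<subseteq> {..j}"
      by (intro subsetI, rule ccontr) (use t in \<open>auto simp: set_pmf_iff pmf_tail_pmf\<close>)
    then have "\<forall>\<^sub>F n in sequentially. F n (tail_pmf t) \<le> \<alpha> + 1 / Suc j"
      by (intro fin) (auto intro: finite_subset)
    then obtain N where "\<And>n. n \<ge> N \<Longrightarrow> F n (tail_pmf t) \<le> \<alpha> + 1 / Suc j"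
      by (auto simp: eventually_sequentially)
    then have "P j (t, max N (Suc j))"
      using t by (simp add: P_def)
    then show ?thesis ..
  qed
  have "\<exists>s. \<forall>j. P j (s j) \<and> Q j (s j) (s (Suc j))"
  proof (rule dependent_nat_choice)
    have "halving (\<lambda>i. if i = 0 then 1 else 0)" by (auto simp: halving_def)
    from time[OF this, of 0] show "\<exists>x. P 0 x" by auto
  next
    fix x j assume "P j x"
    then obtain t n where x: "x = (t, n)" and t: "halving t" "\<forall>i\<le>j. 0 < t i" "\<forall>i>j. t i = 0"
      by (cases x) (auto simp: P_def)
    \<comment> \<open>The first bound preserves \<open>halving\<close>, the second yields
      \<open>c n * u \<le> 1 / Suc j\<close>; adding 1 to \<open>c n\<close> keeps the denominator
      positive when \<open>c n = 0\<close>.\<close>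
    define u where "u = min (t j / 2) (1 / (Suc j * (c n + 1)))"
    define t' where "t' = t(Suc j := u)"
    have cn: "0 \<le> c n" by (rule c)
    have u: "0 < u" "u \<le> t j / 2" "u \<le> 1 / (Suc j * (c n + 1))"
      using t(2) cn by (auto simp: u_def intro!: divide_pos_pos mult_pos_pos add_nonneg_pos)
    have "c n * u \<le> c n * (1 / (Suc j * (c n + 1)))"
      by (rule mult_left_mono[OF u(3) cn])
    also have "\<dots> = (c n / (c n + 1)) * (1 / Suc j)" by simp
    also have "\<dots> \<le> 1 * (1 / Suc j)"
      using cn by (intro mult_right_mono) auto
    finally have cu: "c n * u \<le> 1 / Suc j" by simp
    have "halving t'"
      using t(1,3) u by (auto simp: halving_def t'_def)
    moreover have "\<forall>i\<le>Suc j. 0 < t' i" "\<forall>i>Suc j. t' i = 0"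
      using t u by (auto simp: t'_def le_Suc_eq)
    ultimately obtain n' where "P (Suc j) (t', n')"
      using time by blast
    moreover have "Q j x (t', n')"
      using cu by (auto simp: Q_def x t'_def)
    ultimately show "\<exists>y. P (Suc j) y \<and> Q j x y" by blast
  qed
  then obtain s where s: "\<And>j. P j (s j)" "\<And>j. Q j (s j) (s (Suc j))" by blast
  define t n where "t = (\<lambda>j. fst (s j))" and "n = (\<lambda>j. snd (s j))"
  have t: "halving (t j)" "\<And>i. i \<le> j \<Longrightarrow> 0 < t j i" "\<And>i. j < i \<Longrightarrow> t j i = 0"
    "Suc j \<le> n j" "F (n j) (tail_pmf (t j)) \<le> \<alpha> + 1 / Suc j" for j
    using s(1)[of j] by (auto simp: P_def t_def n_def split: prod.splits)
  have t_Suc: "i \<le> j \<Longrightarrow> t (Suc j) i = t j i" "c (n j) * t (Suc j) (Suc j) \<le> 1 / Suc j" for i j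
    using s(2)[of j] by (auto simp: Q_def t_def n_def split: prod.splits)
  \<comment> \<open>Entry \<open>i\<close> is final from stage \<open>i\<close> on, so the diagonal
    agrees with \<open>t j\<close> up to \<open>j\<close>.\<close>
  define T where "T i = t i i" for i
  have T: "t j i = T i" if "i \<le> j" for i j
    using that by (induction j rule: dec_induct) (simp_all add: T_def t_Suc(1))
  have "halving T"
    unfolding halving_def
  proof (intro conjI allI)
    fix i
    have "t (Suc i) (Suc i) \<le> t (Suc i) i / 2" using t(1)[of "Suc i"] by (simp add: halving_def)
    then show "T (Suc i) \<le> T i / 2" by (simp add: T)
    show "0 \<le> T i" using t(2)[of i i] by (simp add: T_def)
    show "T 0 = 1" using t(1)[of 0] by (simp add: T_def halving_def)
  qed
  have T_pos: "0 < T i" for i using t(2)[of i i] by (simp add: T_def)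
  \<comment> \<open>A positive value differs from one at most half as large, so every integer gets
    positive mass.\<close>
  have "T i \<noteq> T (Suc i)" for i
    using \<open>halving T\<close> T_pos[of i] unfolding halving_def by (smt (verit) field_sum_of_halves)
  then have "set_pmf (tail_pmf T) = UNIV"
    by (auto simp: set_pmf_iff pmf_tail_pmf[OF \<open>halving T\<close>])
  then have "infinite (set_pmf (tail_pmf T))" by simp
  \<comment> \<open>One error \<open>1 / Suc j\<close> comes from the choice of the time
    \<open>n j\<close>, the other from truncating at \<open>j\<close>.\<close>
  moreover have bound: "F (n j) (tail_pmf T) \<le> \<alpha> + 2 / Suc j" for j
  proof -
    have "t j = (\<lambda>i. if i \<le> j then T i else 0)"
      using T t(3) by (auto simp: fun_eq_iff)
    then have trunc: "map_pmf (min j) (tail_pmf T) = tail_pmf (t j)"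
      using map_pmf_min_tail_pmf[OF \<open>halving T\<close>, of j] by simp
    have "measure_pmf.prob (tail_pmf T) {j<..} = T (Suc j)"
      using prob_tail_pmf_atLeast[OF \<open>halving T\<close>, of "Suc j"] by (simp add: atLeast_Suc_greaterThan)
    then have "F (n j) (tail_pmf T) \<le> F (n j) (tail_pmf (t j)) + c (n j) * T (Suc j)"
      using step[of "n j" "tail_pmf T" j] t(4)[of j] by (simp add: trunc)
    also have "\<dots> \<le> (\<alpha> + 1 / Suc j) + 1 / Suc j"
      using t(5)[of j] t_Suc(2)[of j] by (simp add: T_def)
    finally show ?thesis by simp
  qed
  have "\<exists>m\<ge>N. F m (tail_pmf T) \<le> \<alpha> + e" if "0 < e" for e N
  proof -
    obtain k :: nat where k: "2 / e < k" using reals_Archimedean2 by blast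
    let ?j = "max N k"
    have "2 / e \<le> Suc ?j" using k by linarith
    then have "2 / Suc ?j \<le> e" using that by (simp add: field_simps)
    then have "F (n ?j) (tail_pmf T) \<le> \<alpha> + e" using bound[of ?j] by linarith
    moreover have "N \<le> n ?j" using t(4)[of ?j] by linarith
    ultimately show ?thesis by blast
  qed
  ultimately show ?thesis by blast
qed

section \<open>Limits inferior and the two implications\<close>

text \<open>A limit inferior above \<open>a\<close> would leave room for a real \<open>b > a\<close>
  that is eventually a strict lower bound, against the hypothesis with
  \<open>e = b - a\<close>.\<close>

lemma liminf_ereal_le_if_frequently:
  fixes f :: "nat \<Rightarrow> real"
  assumes "\<And>e N. 0 < e \<Longrightarrow> \<exists>n\<ge>N. f n \<le> a + e"
  shows "liminf (\<lambda>n. ereal (f n)) \<le> ereal a"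
proof (rule ccontr)
  assume "\<not> ?thesis"
  then obtain b where b: "a < b" "ereal b < liminf (\<lambda>n. ereal (f n))"
    by (metis ereal_dense2 ereal_less_ereal_Ex less_ereal.simps(1) not_le)
  then obtain N where "\<And>n. n \<ge> N \<Longrightarrow> b < f n"
    using less_LiminfD[OF b(2)] by (auto simp: eventually_sequentially)
  with assms[of "b - a" N] b(1) show False by force
qed

theorem theorem1:
  fixes \<alpha> :: real and \<phi> :: "nat \<Rightarrow> nat" and A :: "nat \<Rightarrow> (nat \<Rightarrow> nat) \<Rightarrow> real"
  assumes "0 \<le> \<alpha>" and "\<alpha> < 1"
    and "\<phi> \<in> {1..} \<rightarrow> {1..}" and "strict_mono_on {1..} \<phi>"
    and "\<And>n. n \<ge> 1 \<Longrightarrow> A n \<in> borel_measurable (\<Pi>\<^sub>M i\<in>{1..\<phi> n}. count_space UNIV)"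
    and "\<And>n. n \<ge> 1 \<Longrightarrow> A n \<in> ({1..\<phi> n} \<rightarrow>\<^sub>E UNIV) \<rightarrow> {0..1}"
  shows
    "((\<forall>\<mu>\<^sub>1 :: nat pmf. finite (set_pmf \<mu>\<^sub>1) \<longrightarrow>
          limsup (\<lambda>n. ereal (expect \<mu>\<^sub>1 (\<phi> n) (A n))) \<le> ereal \<alpha>) \<longrightarrow>
      (\<exists>\<mu>\<^sub>2 :: nat pmf. infinite (set_pmf \<mu>\<^sub>2) \<and>
          liminf (\<lambda>n. ereal (expect \<mu>\<^sub>2 (\<phi> n) (A n))) \<le> ereal \<alpha>)) \<and>
     ((\<forall>\<mu>\<^sub>2 :: nat pmf. infinite (set_pmf \<mu>\<^sub>2) \<longrightarrow>
          limsup (\<lambda>n. ereal (expect \<mu>\<^sub>2 (\<phi> n) (A n))) \<le> ereal \<alpha>) \<longrightarrow>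
      (\<forall>\<alpha>'. \<alpha> < \<alpha>' \<and> \<alpha>' < 1 \<longrightarrow>
        (\<exists>\<mu>\<^sub>1 :: nat pmf. finite (set_pmf \<mu>\<^sub>1) \<and>
          liminf (\<lambda>n. ereal (expect \<mu>\<^sub>1 (\<phi> n) (A n))) \<le> ereal \<alpha>')))"
proof -
  let ?adm = "\<lambda>B. \<forall>n\<ge>1. B n \<in> borel_measurable (\<Pi>\<^sub>M i\<in>{1..\<phi> n}. count_space UNIV) \<and>
    B n \<in> ({1..\<phi> n} \<rightarrow>\<^sub>E UNIV) \<rightarrow> {0..1::real}"
  have A: "?adm A" using assms(5,6) by blast
  \<comment> \<open>General \<open>B\<close> and \<open>\<beta>\<close> allow two uses: with
    \<open>A\<close> and \<open>\<alpha>\<close>, then with \<open>1 - A n\<close> and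
    \<open>1 - \<alpha>'\<close>.\<close>
  have part1: "\<exists>\<mu>\<^sub>2. infinite (set_pmf \<mu>\<^sub>2) \<and> (\<forall>e>0. \<forall>N. \<exists>n\<ge>N. expect \<mu>\<^sub>2 (\<phi> n) (B n) \<le> \<beta> + e)"
    if "?adm B" "\<And>\<mu>\<^sub>1 e. finite (set_pmf \<mu>\<^sub>1) \<Longrightarrow> 0 < e \<Longrightarrow>
      \<forall>\<^sub>F n in sequentially. expect \<mu>\<^sub>1 (\<phi> n) (B n) \<le> \<beta> + e" for B \<beta>
  proof (rule exists_infinite_support_frequently_le[where c = "\<lambda>n. real (\<phi> n)"])
    show "expect \<mu> (\<phi> n) (B n) \<le> expect (map_pmf (min j) \<mu>) (\<phi> n) (B n) +
        real (\<phi> n) * measure_pmf.prob \<mu> {j<..}" if "n \<ge> 1" for n j \<mu>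
      using \<open>?adm B\<close> that by (blast intro: expect_le_expect_truncation)
  qed (use that(2) in auto)
  show ?thesis
  proof (intro conjI impI allI)
    assume fin: "\<forall>\<mu>\<^sub>1 :: nat pmf. finite (set_pmf \<mu>\<^sub>1) \<longrightarrow>
      limsup (\<lambda>n. ereal (expect \<mu>\<^sub>1 (\<phi> n) (A n))) \<le> ereal \<alpha>"
    have "\<forall>\<^sub>F n in sequentially. expect \<mu>\<^sub>1 (\<phi> n) (A n) \<le> \<alpha> + e"
      if "finite (set_pmf \<mu>\<^sub>1)" "0 < e" for \<mu>\<^sub>1 e
    proof -
      have "limsup (\<lambda>n. ereal (expect \<mu>\<^sub>1 (\<phi> n) (A n))) < ereal (\<alpha> + e)"
        using fin that by (auto intro: le_less_trans)
      from Limsup_lessD[OF this] show ?thesis by eventually_elim simp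
    qed
    from part1[OF A this] show "\<exists>\<mu>\<^sub>2 :: nat pmf. infinite (set_pmf \<mu>\<^sub>2) \<and>
        liminf (\<lambda>n. ereal (expect \<mu>\<^sub>2 (\<phi> n) (A n))) \<le> ereal \<alpha>"
      by (auto intro!: liminf_ereal_le_if_frequently)
  next
    fix \<alpha>' assume inf: "\<forall>\<mu>\<^sub>2 :: nat pmf. infinite (set_pmf \<mu>\<^sub>2) \<longrightarrow>
        limsup (\<lambda>n. ereal (expect \<mu>\<^sub>2 (\<phi> n) (A n))) \<le> ereal \<alpha>"
      and \<alpha>': "\<alpha> < \<alpha>' \<and> \<alpha>' < 1"
    define B where "B = (\<lambda>n x. 1 - A n x)"
    have B: "?adm B"
      using A by (auto simp: B_def Pi_iff intro!: borel_measurable_diff)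
    have expect_B: "expect \<mu> (\<phi> n) (B n) = 1 - expect \<mu> (\<phi> n) (A n)" if "n \<ge> 1" for n \<mu>
    proof -
      interpret prob_space "path_measure \<mu>"
        unfolding path_measure_def by (rule prob_space_PiM) (rule prob_space_measure_pmf)
      have "(\<lambda>\<omega>. \<lambda>i\<in>{1..\<phi> n}. X i \<omega>) \<in>
          measurable (path_measure \<mu>) (\<Pi>\<^sub>M i\<in>{1..\<phi> n}. count_space UNIV)"
        unfolding path_measure_def X_def by (rule measurable_restrict) simp
      then have "(\<lambda>\<omega>. A n (\<lambda>i\<in>{1..\<phi> n}. X i \<omega>)) \<in> borel_measurable (path_measure \<mu>)"
        using A that by (auto intro: measurable_compose)
      moreover have "\<bar>A n (\<lambda>i\<in>{1..\<phi> n}. X i \<omega>)\<bar> \<le> 1" for \<omega>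
        using A that by (auto simp: Pi_iff)
      ultimately have "integrable (path_measure \<mu>) (\<lambda>\<omega>. A n (\<lambda>i\<in>{1..\<phi> n}. X i \<omega>))"
        by (intro integrable_const_bound[where B = 1]) auto
      then show ?thesis
        unfolding expect_def B_def by (simp add: prob_space)
    qed
    show "\<exists>\<mu>\<^sub>1 :: nat pmf. finite (set_pmf \<mu>\<^sub>1) \<and>
        liminf (\<lambda>n. ereal (expect \<mu>\<^sub>1 (\<phi> n) (A n))) \<le> ereal \<alpha>'"
    proof (rule ccontr)
      \<comment> \<open>Every finitely supported law now has limit inferior above
        \<open>\<alpha>'\<close>, so the complements \<open>B n\<close> have expectations eventually
        below \<open>1 - \<alpha>'\<close>, and \<open>part1\<close> applies.\<close>
      assume *: "\<not> ?thesis"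
      have "\<forall>\<^sub>F n in sequentially. expect \<mu>\<^sub>1 (\<phi> n) (B n) \<le> (1 - \<alpha>') + e"
        if "finite (set_pmf \<mu>\<^sub>1)" "0 < e" for \<mu>\<^sub>1 e
      proof -
        have "ereal \<alpha>' < liminf (\<lambda>n. ereal (expect \<mu>\<^sub>1 (\<phi> n) (A n)))"
          using * that(1) by (meson not_le)
        from less_LiminfD[OF this] eventually_ge_at_top[of 1] show ?thesis
          by eventually_elim (use that(2) expect_B in simp)
      qed
      from part1[OF B this] obtain \<mu> where \<mu>: "infinite (set_pmf \<mu>)"
        "\<And>e N. 0 < e \<Longrightarrow> \<exists>n\<ge>N. expect \<mu> (\<phi> n) (B n) \<le> (1 - \<alpha>') + e" by blast
      \<comment> \<open>Half the gap: eventually the expectation of \<open>A n\<close> is below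
        \<open>\<alpha> + ?e\<close>, yet at arbitrarily late times it is at least
        \<open>\<alpha>' - ?e\<close>, which is the same number.\<close>
      let ?e = "(\<alpha>' - \<alpha>) / 2"
      have "limsup (\<lambda>n. ereal (expect \<mu> (\<phi> n) (A n))) < ereal (\<alpha> + ?e)"
        using inf \<mu>(1) \<alpha>' by (auto intro: le_less_trans)
      from Limsup_lessD[OF this] obtain N where
        "\<And>n. n \<ge> N \<Longrightarrow> expect \<mu> (\<phi> n) (A n) < \<alpha> + ?e"
        by (auto simp: eventually_sequentially)
      moreover obtain n where "n \<ge> max N 1" "expect \<mu> (\<phi> n) (B n) \<le> (1 - \<alpha>') + ?e"
        using \<mu>(2)[of ?e "max N 1"] \<alpha>' by auto
      ultimately show False
        using expect_B[of n \<mu>] by (auto simp: field_simps) (smt (verit))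
    qed
  qed
qed

end
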